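(* Let $\mathbb{K}=\mathbb{R}$ or $\mathbb{K}=\mathbb{C}$, and let $U\in\mathbb{K}^{m\times N}$ be a matrix whose columns $u_1,\dots,u_N\in\mathbb{K}^m$ form a biangular Parseval frame for $\mathbb{K}^m$. Then $$\lambda_{\mathbb{K}}(U)=\mu_{\mathbb{K}}(U).$$
   Context: A system $(u_1,\dots,u_N)$ of vectors in $\mathbb{K}^m$ is a Parseval frame (a tight frame with constant $1$) if the matrix $U\in\mathbb{K}^{m\times N}$ with columns $u_1,\dots,u_N$ satisfies $UU^*=\mathrm{I}_m$; equivalently $\|x\|^2=\sum_{k=1}^N|\langle x,u_k\rangle|^2$ for all $x\in\mathbb{K}^m$. A system $(u_j)_{j=1}^N$ of vectors with equal norms in $\mathbb{K}^m$ is called biangular if there exist real numbers $b>c\ge 0$ such that $|\langle u_i,u_j\rangle|\in\{b,c\}$ for all $i\neq j$ in $\{1,\dots,N\}$. For a matrix $U$ with columns $u_1,\dots,u_N\in\mathbb{K}^m$ define $$\mu_{\mathbb{K}}(U)=\frac1N\sum_{i,j=1}^N|\langle u_i,u_j\rangle|,$$ $$\lambda_{\mathbb{K}}(U)=\max\Big\{\sum_{i,j=1}^N t_it_j|\langle u_i,u_j\rangle| : t\in\mathbb{R}_+^N,\ \|t\|_2=1\Big\},$$ where $\mathbb{R}_+^N$ denotes the set of vectors with nonnegative real coordinates. *)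

theory Defs
  imports "Jordan_Normal_Form.Schur_Decomposition" "HOL-Analysis.L2_Norm"
begin

text \<open>
  A system of N vectors in K^m is given by the columns of a matrix with m rows and N columns,
  indexed from 0 to N - 1. The sort \<open>{conjugatable_field, real_normed_field}\<close> has \<open>real\<close> and
  \<open>complex\<close> as instances; \<open>conjugate\<close> is the identity on \<open>real\<close> and \<open>cnj\<close> on \<open>complex\<close>.
\<close>

definition vec_l2_norm :: "'a::real_normed_field vec \<Rightarrow> real"
  where "vec_l2_norm v = L2_set (\<lambda>k. norm (v $ k)) {..<dim_vec v}"

definition abs_inner_cols :: "'a::{conjugatable_field, real_normed_field} mat \<Rightarrow> nat \<Rightarrow> nat \<Rightarrow> real"
  where "abs_inner_cols U i j = norm (col U i \<bullet>c col U j)"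

definition parseval_frame :: "'a::conjugatable_field mat \<Rightarrow> bool"
  where "parseval_frame U \<longleftrightarrow> U * mat_adjoint U = 1\<^sub>m (dim_row U)"

definition biangular :: "'a::{conjugatable_field, real_normed_field} mat \<Rightarrow> bool"
  where "biangular U \<longleftrightarrow>
    (\<forall>i<dim_col U. \<forall>j<dim_col U. vec_l2_norm (col U i) = vec_l2_norm (col U j)) \<and>
    (\<exists>b c. b > c \<and> c \<ge> 0 \<and>
      (\<forall>i<dim_col U. \<forall>j<dim_col U. i \<noteq> j \<longrightarrow> abs_inner_cols U i j \<in> {b, c}))"

definition mu :: "'a::{conjugatable_field, real_normed_field} mat \<Rightarrow> real"
  where "mu U = 1 / real (dim_col U) *
    (\<Sum>i<dim_col U. \<Sum>j<dim_col U. abs_inner_cols U i j)"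

text \<open>
  \<open>Max\<close> is only meaningful on finite sets, so the maximum over the nonnegative part of the unit
  sphere is written with \<open>GREATEST\<close>: unlike a supremum, it denotes a value that is attained.
\<close>

definition lambda :: "'a::{conjugatable_field, real_normed_field} mat \<Rightarrow> real"
  where "lambda U = (GREATEST r. \<exists>t \<in> carrier_vec (dim_col U).
    (\<forall>i<dim_col U. t $ i \<ge> 0) \<and> vec_l2_norm t = 1 \<and>
    r = (\<Sum>i<dim_col U. \<Sum>j<dim_col U. t $ i * t $ j * abs_inner_cols U i j))"

end

theory Submission
  imports Defs
begin

text \<open>
  The Gram matrix of a Parseval frame is a projection, so the squared moduli in its \<open>i\<close>-th row
  add up to the squared norm of the \<open>i\<close>-th vector. Off the diagonal a modulus \<open>a\<close> is a root of
  \<open>(a - b) * (a - c)\<close>, i.e. an affine function of its own square; hence the matrix of moduli has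
  constant row sums. For a symmetric nonnegative matrix with constant row sums the quadratic form
  is maximised over the unit sphere by the constant vector (Schur test), and the maximum is the
  row sum.
\<close>

lemma vec_l2_norm_power2:
  "(vec_l2_norm v)\<^sup>2 = (\<Sum>k<dim_vec v. (norm (v $ k))\<^sup>2)"
  by (simp add: vec_l2_norm_def L2_set_def sum_nonneg)

text \<open>This is the Schur test with constant weights: the inequality of arithmetic and geometric
  means splits each product \<open>t i * t j\<close>, and either half then contributes
  \<open>s / 2\<close> times the sum of squares.\<close>

lemma quadratic_form_le_row_sum:
  fixes A :: "nat \<Rightarrow> nat \<Rightarrow> real" and t :: "nat \<Rightarrow> real"
  assumes nonneg: "\<And>i j. i < N \<Longrightarrow> j < N \<Longrightarrow> A i j \<ge> 0"
    and sym: "\<And>i j. i < N \<Longrightarrow> j < N \<Longrightarrow> A i j = A j i"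
    and row: "\<And>i. i < N \<Longrightarrow> (\<Sum>j<N. A i j) = s"
  shows "(\<Sum>i<N. \<Sum>j<N. t i * t j * A i j) \<le> s * (\<Sum>i<N. (t i)\<^sup>2)"
proof -
  have "(\<Sum>i<N. \<Sum>j<N. t i * t j * A i j)
      \<le> (\<Sum>i<N. \<Sum>j<N. ((t i)\<^sup>2 / 2 * A i j + (t j)\<^sup>2 / 2 * A i j))"
  proof (intro sum_mono)
    fix i j assume ij: "i \<in> {..<N}" "j \<in> {..<N}"
    have "t i * t j \<le> (t i)\<^sup>2 / 2 + (t j)\<^sup>2 / 2"
      using sum_squares_bound[of "t i" "t j"] by simp
    then have "t i * t j * A i j \<le> ((t i)\<^sup>2 / 2 + (t j)\<^sup>2 / 2) * A i j"
      using nonneg ij by (intro mult_right_mono) auto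
    then show "t i * t j * A i j \<le> (t i)\<^sup>2 / 2 * A i j + (t j)\<^sup>2 / 2 * A i j"
      by (simp add: distrib_right)
  qed
  also have "\<dots> = (\<Sum>i<N. \<Sum>j<N. (t i)\<^sup>2 / 2 * A i j) + (\<Sum>i<N. \<Sum>j<N. (t j)\<^sup>2 / 2 * A i j)"
    by (simp add: sum.distrib)
  \<comment> \<open>Swapping the sums and using symmetry turns the second half into a renaming of
    the first, so the row sums evaluate both.\<close>
  also have "(\<Sum>i<N. \<Sum>j<N. (t j)\<^sup>2 / 2 * A i j) = (\<Sum>j<N. \<Sum>i<N. (t j)\<^sup>2 / 2 * A j i)"
    by (subst sum.swap) (intro sum.cong refl, use sym in auto)
  also have "(\<Sum>i<N. \<Sum>j<N. (t i)\<^sup>2 / 2 * A i j) = (\<Sum>i<N. (t i)\<^sup>2 / 2 * s)"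
    by (intro sum.cong refl) (simp only: row lessThan_iff flip: sum_distrib_left)
  finally show ?thesis
    by (simp add: sum_distrib_left mult.commute flip: sum.distrib)
qed

text \<open>The sort leaves \<open>conjugate\<close> and \<open>norm\<close> unrelated, so their
  compatibility enters as a hypothesis.\<close>

lemma abs_inner_cols_commute:
  fixes U :: "'a::{conjugatable_field, real_normed_field} mat"
  assumes norm_conj: "\<And>x::'a. norm (conjugate x) = norm x"
  shows "abs_inner_cols U i j = abs_inner_cols U j i"
proof -
  have "col U i \<bullet>c col U j = conjugate (col U j \<bullet>c col U i)"
    by (simp add: scalar_prod_def sum_conjugate conjugate_dist_mul mult.commute)
  then show ?thesis
    by (simp add: abs_inner_cols_def norm_conj)
qed

lemma lambda_eq_mu_if_constant_row_sums:
  fixes U :: "'a::{conjugatable_field, real_normed_field} mat"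
  assumes norm_conj: "\<And>x::'a. norm (conjugate x) = norm x"
    and pos: "dim_col U > 0"
    and row: "\<And>i. i < dim_col U \<Longrightarrow> (\<Sum>j<dim_col U. abs_inner_cols U i j) = s"
  shows "lambda U = mu U"
proof -
  let ?N = "dim_col U"
  have "lambda U = s"
    unfolding lambda_def
  proof (rule Greatest_equality)
    \<comment> \<open>The witness is the constant unit vector; it attains the row sum
      \<open>s\<close>.\<close>
    let ?t = "vec ?N (\<lambda>_. 1 / sqrt ?N)"
    have "(vec_l2_norm ?t)\<^sup>2 = 1"
      using pos by (simp add: vec_l2_norm_power2 power_divide)
    then have norm1: "vec_l2_norm ?t = 1"
      by (simp add: vec_l2_norm_def power2_eq_1_iff) (smt (verit) L2_set_nonneg)
    have "(\<Sum>i<?N. \<Sum>j<?N. ?t $ i * ?t $ j * abs_inner_cols U i j)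
        = (\<Sum>i<?N. \<Sum>j<?N. 1 / ?N * abs_inner_cols U i j)"
      by (intro sum.cong refl) (simp flip: real_sqrt_mult)
    also have "\<dots> = s"
      using pos row by (simp flip: sum_distrib_left sum_divide_distrib)
    finally show "\<exists>t\<in>carrier_vec ?N. (\<forall>i<?N. t $ i \<ge> 0) \<and> vec_l2_norm t = 1 \<and>
        s = (\<Sum>i<?N. \<Sum>j<?N. t $ i * t $ j * abs_inner_cols U i j)"
      using norm1 by (intro bexI[of _ ?t]) auto
  next
    fix r
    assume "\<exists>t\<in>carrier_vec ?N. (\<forall>i<?N. t $ i \<ge> 0) \<and> vec_l2_norm t = 1 \<and>
        r = (\<Sum>i<?N. \<Sum>j<?N. t $ i * t $ j * abs_inner_cols U i j)"
    then obtain t where t: "dim_vec t = ?N" "vec_l2_norm t = 1"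
      and r: "r = (\<Sum>i<?N. \<Sum>j<?N. t $ i * t $ j * abs_inner_cols U i j)"
      by (elim bexE conjE) (rule that, auto)
    have "r \<le> s * (\<Sum>i<?N. (t $ i)\<^sup>2)"
      unfolding r
      by (rule quadratic_form_le_row_sum)
        (use row abs_inner_cols_commute[OF norm_conj] in \<open>auto simp: abs_inner_cols_def\<close>)
    also have "(\<Sum>i<?N. (t $ i)\<^sup>2) = 1"
      using vec_l2_norm_power2[of t] t by simp
    finally show "r \<le> s" by simp
  qed
  also have "s = mu U"
    using pos row by (simp add: mu_def)
  finally show ?thesis .
qed

lemma inner_cols_eq_sum:
  "col U i \<bullet>c col U j = (\<Sum>k<dim_row U. U $$ (k, i) * conjugate (U $$ (k, j)))"
  if "i < dim_col U" "j < dim_col U"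
  using that by (simp add: scalar_prod_def lessThan_atLeast0)

lemma parseval_frame_entry:
  fixes U :: "'a::conjugatable_field mat"
  assumes "parseval_frame U" "k < dim_row U" "l < dim_row U"
  shows "(\<Sum>j<dim_col U. U $$ (k, j) * conjugate (U $$ (l, j))) = (if k = l then 1 else 0)"
proof -
  have "(U * mat_adjoint U) $$ (k, l) = (\<Sum>j<dim_col U. U $$ (k, j) * conjugate (U $$ (l, j)))"
    using assms(2,3)
    by (simp add: mat_adjoint_def mat_of_rows_def scalar_prod_def lessThan_atLeast0)
  with assms show ?thesis
    by (simp add: parseval_frame_def)
qed

lemma parseval_frame_gram_idem:
  fixes U :: "'a::conjugatable_field mat"
  assumes pf: "parseval_frame U" and i: "i < dim_col U"
  shows "(\<Sum>j<dim_col U. (col U i \<bullet>c col U j) * conjugate (col U i \<bullet>c col U j))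
       = col U i \<bullet>c col U i"
proof -
  let ?m = "dim_row U" and ?N = "dim_col U"
  have "(\<Sum>j<?N. (col U i \<bullet>c col U j) * conjugate (col U i \<bullet>c col U j))
      = (\<Sum>j<?N. \<Sum>k<?m. \<Sum>l<?m. U $$ (k, i) * conjugate (U $$ (l, i)) *
          (U $$ (l, j) * conjugate (U $$ (k, j))))"
  proof (intro sum.cong refl)
    fix j assume "j \<in> {..<?N}"
    then have "(col U i \<bullet>c col U j) * conjugate (col U i \<bullet>c col U j)
        = (\<Sum>k<?m. \<Sum>l<?m. U $$ (k, i) * conjugate (U $$ (k, j)) *
            (conjugate (U $$ (l, i)) * U $$ (l, j)))"
      using i by (simp add: inner_cols_eq_sum sum_conjugate conjugate_dist_mul sum_product)
    then show "(col U i \<bullet>c col U j) * conjugate (col U i \<bullet>c col U j)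
        = (\<Sum>k<?m. \<Sum>l<?m. U $$ (k, i) * conjugate (U $$ (l, i)) *
            (U $$ (l, j) * conjugate (U $$ (k, j))))"
      by (simp add: mult_ac)
  qed
  also have "\<dots> = (\<Sum>k<?m. \<Sum>j<?N. \<Sum>l<?m. U $$ (k, i) * conjugate (U $$ (l, i)) *
          (U $$ (l, j) * conjugate (U $$ (k, j))))"
    by (rule sum.swap)
  also have "\<dots> = (\<Sum>k<?m. \<Sum>l<?m. U $$ (k, i) * conjugate (U $$ (l, i)) *
          (\<Sum>j<?N. U $$ (l, j) * conjugate (U $$ (k, j))))"
    by (subst sum_distrib_left, intro sum.cong refl sum.swap)
  \<comment> \<open>The inner sum is the entry \<open>(l, k)\<close> of the identity matrix, so only
    \<open>l = k\<close> survives.\<close>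
  also have "\<dots> = (\<Sum>k<?m. U $$ (k, i) * conjugate (U $$ (k, i)))"
    by (simp add: parseval_frame_entry[OF pf] if_distrib cong: if_cong)
  finally show ?thesis
    using i by (simp add: inner_cols_eq_sum)
qed

text \<open>The hypothesis \<open>mult_conj\<close> isolates what the real and complex cases share;
  it also forces conjugation to preserve the norm.\<close>

lemma lambda_eq_mu:
  fixes U :: "'a::{conjugatable_field, real_normed_field} mat"
  assumes mult_conj: "\<And>x::'a. x * conjugate x = of_real ((norm x)\<^sup>2)"
    and pos: "dim_col U > 0" and ba: "biangular U" and pf: "parseval_frame U"
  shows "lambda U = mu U"
proof -
  let ?N = "dim_col U" and ?A = "abs_inner_cols U"
  have norm_conj: "norm (conjugate x) = norm x" for x :: 'a
  proof (cases "x = 0")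
    case False
    have "norm x * norm (conjugate x) = (norm x)\<^sup>2"
      by (simp add: mult_conj norm_power flip: norm_mult)
    with False show ?thesis by (simp add: power2_eq_square)
  qed simp
  \<comment> \<open>The common squared norm of the columns, read off column 0, which exists by
    \<open>pos\<close>.\<close>
  define d where "d = (vec_l2_norm (col U 0))\<^sup>2"
  from ba obtain b c where bc: "b > c" "c \<ge> 0"
    and angle: "\<And>i j. i < ?N \<Longrightarrow> j < ?N \<Longrightarrow> i \<noteq> j \<Longrightarrow> ?A i j \<in> {b, c}"
    unfolding biangular_def by blast
  have self: "col U i \<bullet>c col U i = of_real d" if "i < ?N" for i
  proof -
    have "vec_l2_norm (col U i) = vec_l2_norm (col U 0)"
      using ba that pos unfolding biangular_def by blast
    then have "d = (\<Sum>k<dim_row U. (norm (U $$ (k, i)))\<^sup>2)"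
      using that by (simp add: d_def vec_l2_norm_power2 flip: \<open>vec_l2_norm (col U i) = _\<close>)
    then show ?thesis
      using that by (simp add: inner_cols_eq_sum mult_conj)
  qed
  have diag: "?A i i = d" if "i < ?N" for i
    using self[OF that] by (simp add: abs_inner_cols_def d_def norm_power)
  have squares: "(\<Sum>j<?N. (?A i j)\<^sup>2) = d" if "i < ?N" for i
  proof -
    have "of_real (\<Sum>j<?N. (?A i j)\<^sup>2) = (of_real d :: 'a)"
      using parseval_frame_gram_idem[OF pf that] self[OF that]
      by (simp add: mult_conj abs_inner_cols_def)
    then show ?thesis by (simp only: of_real_eq_iff)
  qed
  \<comment> \<open>The diagonal gives \<open>d\<close>. The other squares add up to
    \<open>d - d\<^sup>2\<close>, and each of the \<open>?N - 1\<close> affine expressions adds a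
    constant \<open>b * c\<close>. Division is safe since \<open>b > c\<close> and
    \<open>c \<ge> 0\<close> make \<open>b + c\<close> positive. The value does not depend on
    \<open>i\<close>.\<close>
  have "(\<Sum>j<?N. ?A i j) = d + (d - d\<^sup>2 + real (?N - 1) * (b * c)) / (b + c)" if i: "i < ?N" for i
  proof -
    have "?A i j = ((?A i j)\<^sup>2 + b * c) / (b + c)" if "j \<in> {..<?N} - {i}" for j
      using angle[OF i, of j] that bc by (auto simp: field_simps power2_eq_square)
    then have "(\<Sum>j\<in>{..<?N} - {i}. ?A i j) = (\<Sum>j\<in>{..<?N} - {i}. ((?A i j)\<^sup>2 + b * c) / (b + c))"
      by (rule sum.cong[OF refl])
    also have "\<dots> = ((\<Sum>j\<in>{..<?N} - {i}. (?A i j)\<^sup>2) + real (?N - 1) * (b * c)) / (b + c)"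
      using i by (simp add: sum.distrib flip: sum_divide_distrib)
    also have "(\<Sum>j\<in>{..<?N} - {i}. (?A i j)\<^sup>2) = d - d\<^sup>2"
      using squares[OF i] diag[OF i] i by (simp add: sum_diff1)
    finally show ?thesis
      using diag[OF i] i by (simp add: sum.remove[of "{..<?N}" i])
  qed
  then show ?thesis
    using norm_conj pos by (intro lambda_eq_mu_if_constant_row_sums)
qed

text \<open>With \<open>N > 0\<close> unit vectors exist, so the maximum in \<open>lambda\<close>
  ranges over a nonempty set. Each field only has to supply \<open>mult_conj\<close>.\<close>

theorem lemma2p1:
  fixes m N :: nat
  assumes "N > 0"
  shows "(\<forall>U :: real mat. U \<in> carrier_mat m N \<longrightarrow> biangular U \<longrightarrow> parseval_frame U
            \<longrightarrow> lambda U = mu U) \<and>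
         (\<forall>U :: complex mat. U \<in> carrier_mat m N \<longrightarrow> biangular U \<longrightarrow> parseval_frame U
            \<longrightarrow> lambda U = mu U)"
proof (intro conjI allI impI)
  fix U :: "real mat"
  assume "U \<in> carrier_mat m N" "biangular U" "parseval_frame U"
  then show "lambda U = mu U"
    using assms by (intro lambda_eq_mu) (auto simp: power2_eq_square)
next
  fix U :: "complex mat"
  assume "U \<in> carrier_mat m N" "biangular U" "parseval_frame U"
  then show "lambda U = mu U"
    using assms by (intro lambda_eq_mu) (auto simp flip: complex_norm_square)
qed

end
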